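(* Let $I\subset\mathbb R$ be an interval and let $(\gamma_h,\gamma_h^d):I\to\Delta_1$ be a spacelike Legendre curve with curvature $(m_h,n_h)$ and $\gamma_h^s=\gamma_h\wedge\gamma_h^d$. Suppose that there exists a smooth function $f:I\to\mathbb R$ such that $m_h(t)+f(t)n_h(t)=0$ for all $t\in I$. Let $\mathcal{HE}^\pm$ and $\mathcal{DE}^\pm$ be the hyperbolic horocyclic evolute and the de Sitter horocyclic evolute of $(\gamma_h,\gamma_h^d)$, and let $\mu^\pm_{\mathcal E}=\mathcal{HE}^\pm\wedge\mathcal{DE}^\pm$. Then, for each choice of sign and at every $t\in I$, $$(\mathcal{HE}^\pm,\mathcal{DE}^\pm,\mu_{\mathcal E}^\pm)^T=N_1^{\mp}(-f)\,R(-\pi/2)\,(\gamma_h,\gamma_h^d,\gamma_h^s)^T .$$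
   Context: All maps are $C^\infty$. $\mathbb R^3_1$ is $\mathbb R^3$ with $\langle x,y\rangle=-x_1y_1+x_2y_2+x_3y_3$ and $x\wedge y=(-(x_2y_3-x_3y_2),\,x_3y_1-x_1y_3,\,x_1y_2-x_2y_1)$. $H^2=\{x:\langle x,x\rangle=-1\}$, $S^2_1=\{x:\langle x,x\rangle=1\}$, $\Delta_1=\{(v,w)\in H^2\times S_1^2:\langle v,w\rangle=0\}$. A spacelike Legendre curve in $\Delta_1$ is a smooth map $(\gamma_h,\gamma_h^d):I\to\Delta_1$ with $\langle\dot\gamma_h,\gamma_h^d\rangle=0$ on $I$. Put $\gamma_h^s=\gamma_h\wedge\gamma_h^d\in S_1^2$. Its curvature $(m_h,n_h)$ is defined by $\dot\gamma_h=m_h\gamma_h^s$, $\dot\gamma_h^d=n_h\gamma_h^s$, $\dot\gamma_h^s=m_h\gamma_h-n_h\gamma_h^d$. Standing assumption: $\{t\in I: n_h(t)\ne0\}$ is dense in $I$ (so $f$ is unique if it exists). Horocyclic evolutes: $\mathcal{HE}^\pm=\gamma_h+f\gamma_h^d+\frac{f^2}{2}(\gamma_h\pm\gamma_h^s)$ and $\mathcal{DE}^\pm=\mp\frac{f^2}{2}\gamma_h\mp f\gamma_h^d+\left(1-\frac{f^2}{2}\right)\gamma_h^s$. Matrices: $R(\phi)=\begin{pmatrix}1&0&0\\0&\cos\phi&-\sin\phi\\0&\sin\phi&\cos\phi\end{pmatrix}$, $N_1^\pm(\phi)=\begin{pmatrix}1+\frac{\phi^2}{2}&\mp\frac{\phi^2}{2}&\phi\\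 \pm\frac{\phi^2}{2}&1-\frac{\phi^2}{2}&\pm\phi\\ \phi&\mp\phi&1\end{pmatrix}$. For a $3\times3$ matrix $A=(a_{ij})$ and vectors $v_1,v_2,v_3\in\mathbb R^3_1$, $A(v_1,v_2,v_3)^T$ denotes the triple whose $i$-th entry is $\sum_j a_{ij}v_j$. Upper signs go together and lower signs go together. *)

theory Defs
  imports "HOL-Analysis.Analysis"
begin

definition mink :: "real^3 \<Rightarrow> real^3 \<Rightarrow> real" where
  "mink x y = - (x$1 * y$1) + x$2 * y$2 + x$3 * y$3"

definition wedge :: "real^3 \<Rightarrow> real^3 \<Rightarrow> real^3" where
  "wedge x y = vector [- (x$2 * y$3 - x$3 * y$2), x$3 * y$1 - x$1 * y$3, x$1 * y$2 - x$2 * y$1]"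

definition hyperbolic_plane :: "(real^3) set" where
  "hyperbolic_plane = {x. mink x x = -1}"

definition de_sitter :: "(real^3) set" where
  "de_sitter = {x. mink x x = 1}"

definition Delta1 :: "((real^3) \<times> (real^3)) set" where
  "Delta1 = {(v, w). v \<in> hyperbolic_plane \<and> w \<in> de_sitter \<and> mink v w = 0}"

definition proper_interval :: "real set \<Rightarrow> bool" where
  "proper_interval I \<longleftrightarrow> is_interval I \<and> interior I \<noteq> {}"

text \<open>\<open>D k\<close> is the \<open>k\<close>-th derivative of \<open>g\<close> on \<open>I\<close>.  Derivatives are taken within \<open>I\<close>, so they
  are one-sided at an endpoint belonging to \<open>I\<close> and ordinary at interior points.\<close>

definition smooth_on :: "real set \<Rightarrow> (real \<Rightarrow> 'a::real_normed_vector) \<Rightarrow> bool" where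
  "smooth_on I g \<longleftrightarrow> (\<exists>D. (\<forall>t\<in>I. D 0 t = g t) \<and>
     (\<forall>k::nat. \<forall>t\<in>I. (D k has_vector_derivative D (Suc k) t) (at t within I)))"

definition spacelike_legendre_curve ::
    "real set \<Rightarrow> (real \<Rightarrow> real^3) \<Rightarrow> (real \<Rightarrow> real^3) \<Rightarrow> bool" where
  "spacelike_legendre_curve I \<gamma> \<gamma>d \<longleftrightarrow>
     smooth_on I \<gamma> \<and> smooth_on I \<gamma>d \<and> (\<forall>t\<in>I. (\<gamma> t, \<gamma>d t) \<in> Delta1) \<and>
     (\<forall>t\<in>I. mink (vector_derivative \<gamma> (at t within I)) (\<gamma>d t) = 0)"

definition frame_s :: "(real \<Rightarrow> real^3) \<Rightarrow> (real \<Rightarrow> real^3) \<Rightarrow> real \<Rightarrow> real^3" where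
  "frame_s \<gamma> \<gamma>d t = wedge (\<gamma> t) (\<gamma>d t)"

definition has_legendre_curvature ::
    "real set \<Rightarrow> (real \<Rightarrow> real^3) \<Rightarrow> (real \<Rightarrow> real^3) \<Rightarrow> (real \<Rightarrow> real) \<Rightarrow> (real \<Rightarrow> real) \<Rightarrow> bool" where
  "has_legendre_curvature I \<gamma> \<gamma>d m n \<longleftrightarrow> (\<forall>t\<in>I.
     (\<gamma> has_vector_derivative m t *\<^sub>R frame_s \<gamma> \<gamma>d t) (at t within I) \<and>
     (\<gamma>d has_vector_derivative n t *\<^sub>R frame_s \<gamma> \<gamma>d t) (at t within I) \<and>
     (frame_s \<gamma> \<gamma>d has_vector_derivative m t *\<^sub>R \<gamma> t - n t *\<^sub>R \<gamma>d t) (at t within I))"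

text \<open>Below, the sign \<open>\<plusminus>\<close> is a real parameter \<open>s \<in> {1, -1}\<close>: \<open>s = 1\<close> selects the upper signs and
  \<open>s = -1\<close> the lower ones.  The function \<open>f\<close> is the one with \<open>m + f n = 0\<close>.\<close>

definition HE :: "real \<Rightarrow> (real \<Rightarrow> real^3) \<Rightarrow> (real \<Rightarrow> real^3) \<Rightarrow> (real \<Rightarrow> real) \<Rightarrow> real \<Rightarrow> real^3" where
  "HE s \<gamma> \<gamma>d f t =
     \<gamma> t + f t *\<^sub>R \<gamma>d t + ((f t)\<^sup>2 / 2) *\<^sub>R (\<gamma> t + s *\<^sub>R frame_s \<gamma> \<gamma>d t)"

definition DE :: "real \<Rightarrow> (real \<Rightarrow> real^3) \<Rightarrow> (real \<Rightarrow> real^3) \<Rightarrow> (real \<Rightarrow> real) \<Rightarrow> real \<Rightarrow> real^3" where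
  "DE s \<gamma> \<gamma>d f t =
     - (s * ((f t)\<^sup>2 / 2)) *\<^sub>R \<gamma> t - (s * f t) *\<^sub>R \<gamma>d t + (1 - (f t)\<^sup>2 / 2) *\<^sub>R frame_s \<gamma> \<gamma>d t"

definition mu_E :: "real \<Rightarrow> (real \<Rightarrow> real^3) \<Rightarrow> (real \<Rightarrow> real^3) \<Rightarrow> (real \<Rightarrow> real) \<Rightarrow> real \<Rightarrow> real^3" where
  "mu_E s \<gamma> \<gamma>d f t = wedge (HE s \<gamma> \<gamma>d f t) (DE s \<gamma> \<gamma>d f t)"

definition Rot :: "real \<Rightarrow> real^3^3" where
  "Rot \<phi> = vector [vector [1, 0, 0],
                   vector [0, cos \<phi>, - sin \<phi>],
                   vector [0, sin \<phi>, cos \<phi>]]"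

definition N1 :: "real \<Rightarrow> real \<Rightarrow> real^3^3" where
  "N1 s \<phi> = vector [vector [1 + \<phi>\<^sup>2 / 2, - (s * (\<phi>\<^sup>2 / 2)), \<phi>],
                    vector [s * (\<phi>\<^sup>2 / 2), 1 - \<phi>\<^sup>2 / 2, s * \<phi>],
                    vector [\<phi>, - (s * \<phi>), 1]]"

text \<open>A triple of vectors is an element of \<open>(real^3)^3\<close>, indexed first by the position in the
  triple, and a matrix acts on the left by combining whole entries.\<close>

definition act_triple :: "real^3^3 \<Rightarrow> (real^3)^3 \<Rightarrow> (real^3)^3" where
  "act_triple A V = (\<chi> i. \<Sum>j\<in>UNIV. A$i$j *\<^sub>R V$j)"

end

theory Submission
  imports Defs
begin

text \<open>
  The identity is linear algebra at each parameter: since \<open>(\<gamma> t, \<gamma>d t)\<close> lies in \<open>\<Delta>\<^sub>1\<close>, the triple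
  \<open>(\<gamma>, \<gamma>d, \<gamma>s)\<close> is a pseudo-orthonormal frame.  The quarter turn \<open>R(-\<pi>/2)\<close> carries this frame to
  \<open>(\<gamma>, \<gamma>s, -\<gamma>d)\<close>, and the first two rows of \<open>N\<^sub>1\<close> are then the coefficients of the two horocyclic
  evolutes.  The third row is where the geometry enters: the Lorentzian identity
  \<open>x \<and> (y \<and> z) = \<langle>x, y\<rangle> z - \<langle>x, z\<rangle> y\<close> yields the multiplication table
  \<open>\<gamma> \<and> \<gamma>d = \<gamma>s\<close>, \<open>\<gamma>d \<and> \<gamma>s = -\<gamma>\<close>, \<open>\<gamma>s \<and> \<gamma> = \<gamma>d\<close> of the frame, and with it the wedge of the evolutes
  is a computation with the \<open>2 \<times> 2\<close> minors of their coefficients.  The terms of degree three and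
  four in \<open>f\<close> cancel, since the square of the sign is \<open>1\<close>, which leaves
  \<open>\<mu> = -f \<gamma> - \<gamma>d \<mp> f \<gamma>s\<close>.
\<close>

lemma wedge_nth:
  "wedge x y $ 1 = - (x$2 * y$3 - x$3 * y$2)"
  "wedge x y $ 2 = x$3 * y$1 - x$1 * y$3"
  "wedge x y $ 3 = x$1 * y$2 - x$2 * y$1"
  by (simp_all add: wedge_def)

text \<open>The Lorentzian counterpart of the Euclidean expansion of a double cross product; the
  timelike first coordinate reverses the sign.\<close>

lemma wedge_wedge: "wedge x (wedge y z) = mink x y *\<^sub>R z - mink x z *\<^sub>R y"
  by (simp add: vec_eq_iff forall_3 wedge_nth mink_def algebra_simps)

lemma wedge_swap: "wedge x y = - wedge y x"
  by (simp add: vec_eq_iff forall_3 wedge_nth)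

lemma mink_commute: "mink x y = mink y x"
  by (simp add: mink_def mult.commute)

text \<open>The wedge is bilinear and alternating, so on a spanning triple it is determined by the three
  wedges of its members, with the minors of the coefficients as weights.\<close>

lemma wedge_linear_combinations:
  "wedge (a *\<^sub>R u + b *\<^sub>R v + c *\<^sub>R w) (a' *\<^sub>R u + b' *\<^sub>R v + c' *\<^sub>R w) =
     (a * b' - b * a') *\<^sub>R wedge u v + (b * c' - c * b') *\<^sub>R wedge v w
       + (c * a' - a * c') *\<^sub>R wedge w u"
  by (simp add: vec_eq_iff forall_3 wedge_nth algebra_simps)

lemma Delta1_frame_wedges:
  assumes "(v, w) \<in> Delta1"
  shows "wedge w (wedge v w) = - v" and "wedge (wedge v w) v = w"
proof -
  have m: "mink v v = -1" "mink w w = 1" "mink v w = 0" "mink w v = 0"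
    using assms by (auto simp: Delta1_def hyperbolic_plane_def de_sitter_def mink_commute)
  show "wedge w (wedge v w) = - v"
    by (simp add: wedge_wedge m)
  show "wedge (wedge v w) v = w"
    by (simp add: wedge_swap[of "wedge v w"] wedge_wedge m)
qed

lemma HE_frame_coordinates:
  "HE s \<gamma> \<gamma>d f t =
     (1 + (f t)\<^sup>2 / 2) *\<^sub>R \<gamma> t + f t *\<^sub>R \<gamma>d t + (s * ((f t)\<^sup>2 / 2)) *\<^sub>R frame_s \<gamma> \<gamma>d t"
  by (simp add: HE_def algebra_simps)

lemma DE_frame_coordinates:
  "DE s \<gamma> \<gamma>d f t =
     (- (s * ((f t)\<^sup>2 / 2))) *\<^sub>R \<gamma> t + (- (s * f t)) *\<^sub>R \<gamma>d t
       + (1 - (f t)\<^sup>2 / 2) *\<^sub>R frame_s \<gamma> \<gamma>d t"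
  by (simp add: DE_def)

lemma mu_E_frame_coordinates:
  assumes "(\<gamma> t, \<gamma>d t) \<in> Delta1" and s: "s * s = 1"
  shows "mu_E s \<gamma> \<gamma>d f t = (- f t) *\<^sub>R \<gamma> t + (-1) *\<^sub>R \<gamma>d t + (- (s * f t)) *\<^sub>R frame_s \<gamma> \<gamma>d t"
proof -
  let ?x = "f t" and ?q = "(f t)\<^sup>2 / 2"
  have frame: "wedge (\<gamma> t) (\<gamma>d t) = frame_s \<gamma> \<gamma>d t"
    "wedge (\<gamma>d t) (frame_s \<gamma> \<gamma>d t) = - \<gamma> t" "wedge (frame_s \<gamma> \<gamma>d t) (\<gamma> t) = \<gamma>d t"
    using Delta1_frame_wedges[OF assms(1)] by (simp_all add: frame_s_def)
  have minors:
    "(1 + ?q) * (- (s * ?x)) - ?x * (- (s * ?q)) = - (s * ?x)"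
    "?x * (1 - ?q) - s * ?q * (- (s * ?x)) = ?x"
    "s * ?q * (- (s * ?q)) - (1 + ?q) * (1 - ?q) = -1"
  proof -
    have "s * s * z = z" for z using s by simp
    from this[of "?q * ?x"] this[of "?q * ?q"] show
      "(1 + ?q) * (- (s * ?x)) - ?x * (- (s * ?q)) = - (s * ?x)"
      "?x * (1 - ?q) - s * ?q * (- (s * ?x)) = ?x"
      "s * ?q * (- (s * ?q)) - (1 + ?q) * (1 - ?q) = -1"
      by (simp_all add: algebra_simps)
  qed
  show ?thesis
    unfolding mu_E_def HE_frame_coordinates DE_frame_coordinates wedge_linear_combinations
      minors frame
    by simp
qed

text \<open>The quarter turn sends \<open>(u, v, w)\<close> to \<open>(u, w, -v)\<close>, so multiplying \<open>N\<^sub>1\<close> by it swaps the last two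
  columns, up to the sign of one of them.\<close>

lemma N1_quarter_turn_act:
  "act_triple (N1 s \<phi> ** Rot (- pi / 2)) (vector [u, v, w]) =
     vector [(1 + \<phi>\<^sup>2 / 2) *\<^sub>R u + (- \<phi>) *\<^sub>R v + (- (s * (\<phi>\<^sup>2 / 2))) *\<^sub>R w,
             (s * (\<phi>\<^sup>2 / 2)) *\<^sub>R u + (- (s * \<phi>)) *\<^sub>R v + (1 - \<phi>\<^sup>2 / 2) *\<^sub>R w,
             \<phi> *\<^sub>R u + (-1) *\<^sub>R v + (- (s * \<phi>)) *\<^sub>R w]"
proof -
  have "cos (- pi / 2) = 0" "sin (- pi / 2) = (-1::real)"
    by (simp_all add: minus_divide_left[symmetric])
  then show ?thesis
    by (simp add: vec_eq_iff[where 'b=3] forall_3 act_triple_def N1_def Rot_def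
        matrix_matrix_mult_def sum_3)
qed

theorem proposition3p4:
  fixes I :: "real set" and \<gamma> \<gamma>d :: "real \<Rightarrow> real^3" and m n f :: "real \<Rightarrow> real"
  assumes "proper_interval I"
    and "spacelike_legendre_curve I \<gamma> \<gamma>d"
    and "has_legendre_curvature I \<gamma> \<gamma>d m n"
    and "I \<subseteq> closure {t \<in> I. n t \<noteq> 0}"
    and "smooth_on I f"
    and "\<forall>t\<in>I. m t + f t * n t = 0"
  shows "\<forall>s\<in>{1, -1::real}. \<forall>t\<in>I.
    (vector [HE s \<gamma> \<gamma>d f t, DE s \<gamma> \<gamma>d f t, mu_E s \<gamma> \<gamma>d f t] :: (real^3)^3) =
      act_triple (N1 (- s) (- f t) ** Rot (- pi / 2))
        (vector [\<gamma> t, \<gamma>d t, frame_s \<gamma> \<gamma>d t])"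
proof (intro ballI)
  fix s t :: real
  assume "s \<in> {1, -1}" and t: "t \<in> I"
  then have s: "s * s = 1" by auto
  have "(\<gamma> t, \<gamma>d t) \<in> Delta1"
    using assms(2) t by (simp add: spacelike_legendre_curve_def)
  then have "mu_E s \<gamma> \<gamma>d f t =
      (- f t) *\<^sub>R \<gamma> t + (-1) *\<^sub>R \<gamma>d t + (- (s * f t)) *\<^sub>R frame_s \<gamma> \<gamma>d t"
    using s by (rule mu_E_frame_coordinates)
  then show "(vector [HE s \<gamma> \<gamma>d f t, DE s \<gamma> \<gamma>d f t, mu_E s \<gamma> \<gamma>d f t] :: (real^3)^3) =
      act_triple (N1 (- s) (- f t) ** Rot (- pi / 2))
        (vector [\<gamma> t, \<gamma>d t, frame_s \<gamma> \<gamma>d t])"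
    unfolding N1_quarter_turn_act HE_frame_coordinates DE_frame_coordinates by simp
qed

end
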